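(* Let $N>2$, $\Omega=\{\omega_1,\dots,\omega_N\}$, and let $\mu_p\in\Delta(\Omega)$ have full support with $\mu_p(\omega_1)\ge\mu_p(\omega_2)\ge\dots\ge\mu_p(\omega_N)>0$. Let $\mu^*\in\Delta(\Omega)$ satisfy $\frac{\mu^*(\omega_i)}{\mu^*(\omega_j)}=\frac{\sqrt{\mu_p(\omega_i)}}{\sqrt{\mu_p(\omega_j)}}$ for all $i,j\in\{1,\dots,N\}$. Then: (i) $\mu^*$ is majorized by $\mu_p$; (ii) $\mu^*$ has (weakly) higher Shannon entropy than $\mu_p$; (iii) $\mu^*(\omega_1)\ge\dots\ge\mu^*(\omega_N)$, $\mu^*(\omega_1)\le\mu_p(\omega_1)$, and $\mu^*(\omega_N)\ge\mu_p(\omega_N)$, with equalities (equality throughout the first chain, equality in the second relation, equality in the third relation, respectively) if and only if $\mu_p(\omega_1)=\dots=\mu_p(\omega_N)$.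
   Context: A distribution $\mu_p\in\Delta(\Omega)$ majorizes $\mu^*\in\Delta(\Omega)$ if both probability vectors are sorted in descending order and $\sum_{i=1}^k\mu_p(\omega_i)\ge\sum_{i=1}^k\mu^*(\omega_i)$ for all $k\in\{1,\dots,N\}$. The Shannon entropy of $\mu$ is $-\sum_i\mu(\omega_i)\ln\mu(\omega_i)$. *)

theory Defs
  imports "HOL-Probability.Probability"
begin

definition distributions_on :: "'a set \<Rightarrow> 'a pmf set" where
  "distributions_on \<Omega> = {\<mu>. set_pmf \<mu> \<subseteq> \<Omega>}"

text \<open>The outcomes are listed as \<open>\<omega> 1, \<dots>, \<omega> N\<close>, so that \<open>pmf \<mu> (\<omega> i)\<close> is the \<open>i\<close>-th entry of
  the probability vector of \<open>\<mu>\<close>. That both vectors are sorted in descending order along this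
  listing is part of the definition.\<close>

definition majorizes :: "nat \<Rightarrow> (nat \<Rightarrow> 'a) \<Rightarrow> 'a pmf \<Rightarrow> 'a pmf \<Rightarrow> bool" where
  "majorizes N \<omega> \<mu> \<nu> \<longleftrightarrow>
     antimono_on {1..N} (\<lambda>i. pmf \<mu> (\<omega> i)) \<and>
     antimono_on {1..N} (\<lambda>i. pmf \<nu> (\<omega> i)) \<and>
     (\<forall>k\<in>{1..N}. (\<Sum>i=1..k. pmf \<mu> (\<omega> i)) \<ge> (\<Sum>i=1..k. pmf \<nu> (\<omega> i)))"

text \<open>Since \<open>ln 0 = 0\<close>, outcomes of probability zero contribute nothing.\<close>

definition shannon_entropy :: "'a set \<Rightarrow> 'a pmf \<Rightarrow> real" where
  "shannon_entropy \<Omega> \<mu> = - (\<Sum>x\<in>\<Omega>. pmf \<mu> x * ln (pmf \<mu> x))"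

end

theory Submission
  imports Defs
begin

text \<open>Let \<open>p\<close> and \<open>s\<close> be the probability vectors of \<open>\<mu>p\<close> and \<open>\<mu>s\<close>, and put \<open>q i = sqrt (p i)\<close>, so that \<open>p i = (q i)\<^sup>2\<close> and \<open>s i = c * q i\<close> for a constant \<open>c\<close>.
  The difference \<open>p i - s i = q i * (q i - c)\<close> sums to zero and, as \<open>q\<close> is decreasing, changes sign
  at most once, from positive to negative; hence all its partial sums are nonnegative. Since \<open>c\<close> is a
  weighted mean of the \<open>q i\<close>, it lies between the last and the first of them and equals one of these
  only if \<open>q\<close> is constant. As \<open>p - s\<close> and \<open>ln s\<close> are similarly ordered,
  the cross entropy \<open>- (\<Sum>i. p i * ln (s i))\<close> is at most the entropy of \<open>s\<close>, and by Gibbs'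
  inequality it is at least the entropy of \<open>p\<close>.\<close>

lemma antimono_on_atLeastAtMost_Suc:
  fixes f :: "nat \<Rightarrow> 'b::preorder"
  assumes "\<And>i. i \<in> {m..<n} \<Longrightarrow> f (Suc i) \<le> f i"
  shows "antimono_on {m..n} f"
proof (rule monotone_onI)
  fix i j assume "i \<in> {m..n}" "j \<in> {m..n}" "i \<le> j"
  from \<open>i \<le> j\<close> \<open>j \<in> {m..n}\<close> \<open>i \<in> {m..n}\<close> show "f j \<le> f i"
  proof (induction rule: dec_induct)
    case (step k)
    then have "f (Suc k) \<le> f k" "f k \<le> f i"
      using assms by auto
    then show ?case by (rule order_trans)
  qed simp
qed

text \<open>Either every term up to \<open>k\<close> is nonnegative, or the tail beyond
  \<open>k\<close> has a nonpositive sum; in the latter case the zero total makes the initial sum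
  the negative of the tail.\<close>

lemma partial_sum_nonneg_if_single_crossing:
  fixes d :: "nat \<Rightarrow> real"
  assumes "sum d {m..n} = 0" and "k \<in> {m..n}"
    and "(\<forall>i\<in>{m..k}. 0 \<le> d i) \<or> (\<forall>i\<in>{k<..n}. d i \<le> 0)"
  shows "0 \<le> sum d {m..k}"
  using assms(3)
proof
  assume "\<forall>i\<in>{m..k}. 0 \<le> d i"
  then show ?thesis by (intro sum_nonneg) auto
next
  assume "\<forall>i\<in>{k<..n}. d i \<le> 0"
  then have "sum d {k<..n} \<le> 0" by (intro sum_nonpos) auto
  moreover have "sum d {m..n} = sum d {m..k} + sum d {k<..n}"
    using assms(2) by (subst sum.union_disjoint[symmetric]) (auto intro: sum.cong)
  ultimately show ?thesis using assms(1) by simp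
qed

text \<open>The quantity \<open>(b - c) * sum w A\<close> is a sum of the nonnegative terms
  \<open>w i * (b - x i)\<close>, so it vanishes only if each of them does.\<close>

lemma weighted_mean_le:
  fixes w x :: "'b \<Rightarrow> real"
  assumes "finite A" "A \<noteq> {}" "\<And>i. i \<in> A \<Longrightarrow> 0 < w i"
    and mean: "(\<Sum>i\<in>A. w i * x i) = c * (\<Sum>i\<in>A. w i)"
    and bound: "\<And>i. i \<in> A \<Longrightarrow> x i \<le> b"
  shows "c \<le> b" and "c = b \<longleftrightarrow> (\<forall>i\<in>A. x i = b)"
proof -
  have pos: "0 < sum w A" using assms(1-3) by (intro sum_pos) auto
  have gap: "(\<Sum>i\<in>A. w i * (b - x i)) = (b - c) * sum w A"
    using mean by (simp add: right_diff_distrib left_diff_distrib sum_subtractf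
        sum_distrib_left mult.commute)
  have nonneg: "0 \<le> w i * (b - x i)" if "i \<in> A" for i
    using assms(3) bound that by (simp add: less_imp_le)
  then have "0 \<le> (b - c) * sum w A"
    unfolding gap[symmetric] by (rule sum_nonneg)
  then show "c \<le> b"
    using pos by (simp add: zero_le_mult_iff)
  have "c = b \<longleftrightarrow> (\<Sum>i\<in>A. w i * (b - x i)) = 0"
    using pos by (auto simp: gap)
  also have "\<dots> \<longleftrightarrow> (\<forall>i\<in>A. w i * (b - x i) = 0)"
    using assms(1) nonneg by (rule sum_nonneg_eq_0_iff)
  also have "\<dots> \<longleftrightarrow> (\<forall>i\<in>A. x i = b)"
    using assms(3) by fastforce
  finally show "c = b \<longleftrightarrow> (\<forall>i\<in>A. x i = b)" .
qed

text \<open>Apply \<open>ln x \<le> x - 1\<close> at \<open>x = s i / p i\<close> and weight by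
  \<open>p i\<close>; the resulting bounds \<open>s i - p i\<close> sum to zero.\<close>

lemma gibbs_inequality:
  fixes p s :: "'b \<Rightarrow> real"
  assumes "\<And>i. i \<in> A \<Longrightarrow> 0 < p i" "\<And>i. i \<in> A \<Longrightarrow> 0 < s i" "sum p A = sum s A"
  shows "(\<Sum>i\<in>A. p i * ln (s i)) \<le> (\<Sum>i\<in>A. p i * ln (p i))"
proof -
  have "p i * ln (s i) - p i * ln (p i) \<le> s i - p i" if "i \<in> A" for i
  proof -
    have pos: "0 < p i" "0 < s i" using assms that by auto
    then have "p i * ln (s i / p i) \<le> p i * (s i / p i - 1)"
      by (intro mult_left_mono ln_le_minus_one) auto
    then show ?thesis
      using pos by (simp add: ln_div right_diff_distrib)
  qed
  then have "(\<Sum>i\<in>A. p i * ln (s i) - p i * ln (p i)) \<le> (\<Sum>i\<in>A. s i - p i)"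
    by (rule sum_mono)
  then show ?thesis
    using assms(3) by (simp add: sum_subtractf)
qed

lemma entropy_le_if_proportional_to_sqrt:
  fixes q :: "'b \<Rightarrow> real"
  assumes q: "\<And>i. i \<in> A \<Longrightarrow> 0 < q i" and c: "0 < c"
    and sums: "(\<Sum>i\<in>A. (q i)\<^sup>2) = (\<Sum>i\<in>A. c * q i)"
  shows "(\<Sum>i\<in>A. c * q i * ln (c * q i)) \<le> (\<Sum>i\<in>A. (q i)\<^sup>2 * ln ((q i)\<^sup>2))"
proof -
  \<comment> \<open>The constant \<open>ln (c * c)\<close> is the value of
    \<open>ln (c * q i)\<close> at the crossing point \<open>q i = c\<close>, so both factors have
    the same sign. After summation it cancels, because the differences
    \<open>(q i)\<^sup>2 - c * q i\<close> sum to zero.\<close>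
  have "0 \<le> ((q i)\<^sup>2 - c * q i) * (ln (c * q i) - ln (c * c))" if "i \<in> A" for i
  proof -
    have "0 \<le> (q i - c) * (ln (q i) - ln c)"
      using q[OF that] c by (simp add: zero_le_mult_iff linorder_linear)
    then have "0 \<le> q i * ((q i - c) * (ln (q i) - ln c))"
      using q[OF that] by simp
    then show ?thesis
      using q[OF that] c by (simp add: ln_mult power2_eq_square algebra_simps)
  qed
  then have "0 \<le> (\<Sum>i\<in>A. ((q i)\<^sup>2 - c * q i) * (ln (c * q i) - ln (c * c)))"
    by (rule sum_nonneg)
  also have "\<dots> = (\<Sum>i\<in>A. (q i)\<^sup>2 * ln (c * q i)) - (\<Sum>i\<in>A. c * q i * ln (c * q i))
      - ((\<Sum>i\<in>A. (q i)\<^sup>2) - (\<Sum>i\<in>A. c * q i)) * ln (c * c)"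
    by (simp add: left_diff_distrib right_diff_distrib sum_subtractf sum_distrib_right)
  finally have "(\<Sum>i\<in>A. c * q i * ln (c * q i)) \<le> (\<Sum>i\<in>A. (q i)\<^sup>2 * ln (c * q i))"
    using sums by simp
  also have "\<dots> \<le> (\<Sum>i\<in>A. (q i)\<^sup>2 * ln ((q i)\<^sup>2))"
    using c sums by (intro gibbs_inequality) (simp_all add: q less_imp_neq[OF q, symmetric])
  finally show ?thesis .
qed

theorem corollary2:
  fixes N :: nat and \<Omega> :: "'a set" and \<omega> :: "nat \<Rightarrow> 'a" and \<mu>p \<mu>s :: "'a pmf"
  assumes "N > 2"
    and "bij_betw \<omega> {1..N} \<Omega>"
    and "\<mu>p \<in> distributions_on \<Omega>"
    and "set_pmf \<mu>p = \<Omega>"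
    and "\<forall>i\<in>{1..<N}. pmf \<mu>p (\<omega> i) \<ge> pmf \<mu>p (\<omega> (Suc i))"
    and "pmf \<mu>p (\<omega> N) > 0"
    and "\<mu>s \<in> distributions_on \<Omega>"
    and "\<forall>i\<in>{1..N}. \<forall>j\<in>{1..N}.
           pmf \<mu>s (\<omega> i) / pmf \<mu>s (\<omega> j) = sqrt (pmf \<mu>p (\<omega> i)) / sqrt (pmf \<mu>p (\<omega> j))"
  shows "majorizes N \<omega> \<mu>p \<mu>s
    \<and> shannon_entropy \<Omega> \<mu>s \<ge> shannon_entropy \<Omega> \<mu>p
    \<and> (\<forall>i\<in>{1..<N}. pmf \<mu>s (\<omega> i) \<ge> pmf \<mu>s (\<omega> (Suc i)))
    \<and> pmf \<mu>s (\<omega> 1) \<le> pmf \<mu>p (\<omega> 1)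
    \<and> pmf \<mu>s (\<omega> N) \<ge> pmf \<mu>p (\<omega> N)
    \<and> ((\<forall>i\<in>{1..<N}. pmf \<mu>s (\<omega> i) = pmf \<mu>s (\<omega> (Suc i)))
         \<longleftrightarrow> (\<forall>i\<in>{1..<N}. pmf \<mu>p (\<omega> i) = pmf \<mu>p (\<omega> (Suc i))))
    \<and> (pmf \<mu>s (\<omega> 1) = pmf \<mu>p (\<omega> 1)
         \<longleftrightarrow> (\<forall>i\<in>{1..<N}. pmf \<mu>p (\<omega> i) = pmf \<mu>p (\<omega> (Suc i))))
    \<and> (pmf \<mu>s (\<omega> N) = pmf \<mu>p (\<omega> N)
         \<longleftrightarrow> (\<forall>i\<in>{1..<N}. pmf \<mu>p (\<omega> i) = pmf \<mu>p (\<omega> (Suc i))))"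
proof -
  define q where "q i = sqrt (pmf \<mu>p (\<omega> i))" for i
  \<comment> \<open>By hypothesis the quotient of the entries of \<open>\<mu>s\<close> and
    \<open>q\<close> is the same at every index; index 1 serves as the representative.\<close>
  define c where "c = pmf \<mu>s (\<omega> 1) / q 1"
  have inj: "inj_on \<omega> {1..N}" and img: "\<omega> ` {1..N} = \<Omega>"
    using assms(2) by (auto simp: bij_betw_def)
  have fin: "finite \<Omega>" using img by (metis finite_atLeastAtMost finite_imageI)
  have reindex: "(\<Sum>x\<in>\<Omega>. f x) = (\<Sum>i=1..N. f (\<omega> i))" for f :: "'a \<Rightarrow> real"
    using sum.reindex[OF inj, of f] img by simp
  have p: "pmf \<mu>p (\<omega> i) = (q i)\<^sup>2" for i
    by (simp add: q_def)
  have q: "0 < q i" if "i \<in> {1..N}" for i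
  proof -
    have "\<omega> i \<in> set_pmf \<mu>p" using that img assms(4) by auto
    then show ?thesis by (simp add: q_def pmf_positive)
  qed
  have ratio: "pmf \<mu>s (\<omega> i) / pmf \<mu>s (\<omega> j) = q i / q j" if "i \<in> {1..N}" "j \<in> {1..N}" for i j
    using assms(8) that by (simp add: q_def)
  have one: "1 \<in> {1..N}" using assms(1) by simp
  \<comment> \<open>Were this probability \<open>0\<close>, its ratio to itself would be \<open>0\<close> rather than \<open>1\<close>.\<close>
  have "pmf \<mu>s (\<omega> 1) \<noteq> 0"
    using ratio[OF one one] q[OF one] by auto
  then have s1: "0 < pmf \<mu>s (\<omega> 1)" by (simp add: order_less_le)
  then have c: "0 < c" using q[OF one] by (simp add: c_def)
  have s: "pmf \<mu>s (\<omega> i) = c * q i" if "i \<in> {1..N}" for i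
    using ratio[OF that one] s1 q[OF one] by (simp add: c_def field_simps)
  have total: "(\<Sum>i=1..N. pmf \<mu> (\<omega> i)) = 1" if "\<mu> \<in> distributions_on \<Omega>" for \<mu>
    using that sum_pmf_eq_1[OF fin, of \<mu>] by (simp add: distributions_on_def reindex)
  have sum_p: "(\<Sum>i=1..N. (q i)\<^sup>2) = 1"
    using total[OF assms(3)] by (simp add: p)
  have sum_s: "(\<Sum>i=1..N. c * q i) = 1"
    using total[OF assms(7)] s by simp
  have anti_p: "antimono_on {1..N} (\<lambda>i. pmf \<mu>p (\<omega> i))"
    using assms(5) by (intro antimono_on_atLeastAtMost_Suc) auto
  have anti_q: "q j \<le> q i" if "i \<in> {1..N}" "j \<in> {1..N}" "i \<le> j" for i j
    using monotone_onD[OF anti_p that] by (simp add: q_def)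
  have anti_s: "antimono_on {1..N} (\<lambda>i. pmf \<mu>s (\<omega> i))"
    using anti_q c s by (intro monotone_onI) simp

  have partial_sums: "(\<Sum>i=1..k. pmf \<mu>s (\<omega> i)) \<le> (\<Sum>i=1..k. pmf \<mu>p (\<omega> i))"
    if k: "k \<in> {1..N}" for k
  proof -
    have "0 \<le> (\<Sum>i=1..k. (q i)\<^sup>2 - c * q i)"
    proof (rule partial_sum_nonneg_if_single_crossing[OF _ k])
      show "(\<Sum>i=1..N. (q i)\<^sup>2 - c * q i) = 0"
        by (simp only: sum_subtractf sum_p sum_s)
      show "(\<forall>i\<in>{1..k}. 0 \<le> (q i)\<^sup>2 - c * q i) \<or> (\<forall>i\<in>{k<..N}. (q i)\<^sup>2 - c * q i \<le> 0)"
      \<comment> \<open>The sign of \<open>q i * (q i - c)\<close> is that of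
        \<open>q i - c\<close>. Since \<open>q\<close> is decreasing, \<open>c \<le> q k\<close>
        settles all earlier indices, and \<open>q k < c\<close> all later ones.\<close>
      proof (cases "c \<le> q k")
        case True
        have "0 \<le> (q i)\<^sup>2 - c * q i" if "i \<in> {1..k}" for i
          using that k True anti_q[of i k] q[of i] by (simp add: power2_eq_square)
        then show ?thesis by blast
      next
        case False
        have "(q i)\<^sup>2 - c * q i \<le> 0" if "i \<in> {k<..N}" for i
          using that k False anti_q[of k i] q[of i] by (simp add: power2_eq_square)
        then show ?thesis by blast
      qed
    qed
    then show ?thesis
      using k s by (simp add: sum_subtractf p)
  qed

  \<comment> \<open>Both sides equal 1 by normalization, which exhibits \<open>c\<close> as the mean
    of \<open>q\<close> under the weights \<open>q\<close>.\<close>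
  have mean: "(\<Sum>i=1..N. q i * q i) = c * (\<Sum>i=1..N. q i)"
    using sum_p sum_s by (simp add: power2_eq_square sum_distrib_left)
  have ne: "{1..N} \<noteq> {}" and last: "N \<in> {1..N}" using assms(1) by auto
  have first_le: "q i \<le> q 1" and last_le: "q N \<le> q i" if "i \<in> {1..N}" for i
    using that anti_q[of 1 i] anti_q[of i N] one last by auto
  note upper = weighted_mean_le[of "{1..N}" q q c "q 1",
      OF finite_atLeastAtMost ne q mean first_le]
  \<comment> \<open>Negating the values, but not the weights, turns the upper bound on a mean into a
    lower bound.\<close>
  have neg_mean: "(\<Sum>i=1..N. q i * - q i) = - c * (\<Sum>i=1..N. q i)"
    using mean by (simp add: sum_negf)
  have lower: "- c \<le> - q N" "- c = - q N \<longleftrightarrow> (\<forall>i\<in>{1..N}. - q i = - q N)"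
    using weighted_mean_le[of "{1..N}" q "\<lambda>i. - q i" "- c" "- q N",
      OF finite_atLeastAtMost ne q neg_mean] last_le by auto

  have chain_eq: "(\<forall>i\<in>{1..<N}. q i = q (Suc i)) \<longleftrightarrow> (\<forall>i\<in>{1..N}. q i = q 1)"
  proof
    assume step: "\<forall>i\<in>{1..<N}. q i = q (Suc i)"
    \<comment> \<open>Equal neighbours make \<open>- q\<close> decreasing as well, whence
      \<open>q 1 \<le> q i\<close>; \<open>first_le\<close> gives the converse.\<close>
    have "antimono_on {1..N} (\<lambda>i. - q i)"
      using step by (intro antimono_on_atLeastAtMost_Suc) auto
    from monotone_onD[OF this one] show "\<forall>i\<in>{1..N}. q i = q 1"
      using first_le by force
  next
    assume const: "\<forall>i\<in>{1..N}. q i = q 1"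
    show "\<forall>i\<in>{1..<N}. q i = q (Suc i)"
    proof
      fix i assume "i \<in> {1..<N}"
      then have "i \<in> {1..N}" "Suc i \<in> {1..N}" by auto
      then show "q i = q (Suc i)" using const by metis
    qed
  qed
  have chain_p: "(\<forall>i\<in>{1..<N}. pmf \<mu>p (\<omega> i) = pmf \<mu>p (\<omega> (Suc i)))
      \<longleftrightarrow> (\<forall>i\<in>{1..N}. q i = q 1)"
    unfolding chain_eq[symmetric] by (simp add: q_def)
  have chain_s: "(\<forall>i\<in>{1..<N}. pmf \<mu>s (\<omega> i) = pmf \<mu>s (\<omega> (Suc i)))
      \<longleftrightarrow> (\<forall>i\<in>{1..N}. q i = q 1)"
    unfolding chain_eq[symmetric] using s c by simp
  have last_const: "(\<forall>i\<in>{1..N}. q i = q N) \<longleftrightarrow> (\<forall>i\<in>{1..N}. q i = q 1)"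
    using one last by metis

  have "majorizes N \<omega> \<mu>p \<mu>s"
    using anti_p anti_s partial_sums by (auto simp: majorizes_def)
  moreover have "shannon_entropy \<Omega> \<mu>p \<le> shannon_entropy \<Omega> \<mu>s"
    using entropy_le_if_proportional_to_sqrt[of "{1..N}" q c] q c sum_p sum_s s
    by (simp add: shannon_entropy_def reindex p)
  moreover have "\<forall>i\<in>{1..<N}. pmf \<mu>s (\<omega> (Suc i)) \<le> pmf \<mu>s (\<omega> i)"
    using anti_s by (auto simp: monotone_on_def)
  \<comment> \<open>Here and in the remaining claims, comparing \<open>c * q i\<close> with
    \<open>q i * q i\<close> at an end of the listing amounts to comparing \<open>c\<close> with
    \<open>q i\<close>, as \<open>q i\<close> is positive.\<close>
  moreover have "pmf \<mu>s (\<omega> 1) \<le> pmf \<mu>p (\<omega> 1)"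
    using upper(1) q[OF one] unfolding s[OF one] p power2_eq_square by simp
  moreover have "pmf \<mu>p (\<omega> N) \<le> pmf \<mu>s (\<omega> N)"
    using lower(1) q[OF last] unfolding s[OF last] p power2_eq_square by simp
  moreover have "pmf \<mu>s (\<omega> 1) = pmf \<mu>p (\<omega> 1) \<longleftrightarrow> (\<forall>i\<in>{1..N}. q i = q 1)"
    using upper(2) q[OF one] unfolding s[OF one] p power2_eq_square by simp
  moreover have "pmf \<mu>s (\<omega> N) = pmf \<mu>p (\<omega> N) \<longleftrightarrow> (\<forall>i\<in>{1..N}. q i = q 1)"
    using lower(2) last_const q[OF last]
    unfolding s[OF last] p power2_eq_square by simp
  ultimately show ?thesis
    unfolding chain_p chain_s by blast
qed

end
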